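(* Let $L\ge 3$ be an integer, $\alpha,\sigma\in[-1,1]$, $\gamma\in[0,1]$, $p_\lambda\in[0,1/2]$, $f_{cl}\in[0,1]$. Consider the system for the nonnegative variables $R_0,\dots,R_L,Q_0,\dots,Q_L$ with $\sum_kR_k=1-f_{cl}$ and $\sum_kQ_k=f_{cl}$: $$\frac{dR_0}{dt}=-R_0e_0^{(reg)}+R_1(1-e_1^{(reg)}),\qquad \frac{dR_L}{dt}=R_{L-1}e_{L-1}^{(reg)}-R_L(1-e_L^{(reg)}),$$ $$\frac{dR_k}{dt}=R_{k-1}e_{k-1}^{(reg)}-R_k+R_{k+1}(1-e_{k+1}^{(reg)}),\qquad k=1,\dots,L-1,$$ $$\frac{dQ_0}{dt}=-Q_0e_0^{(cl)}+Q_1(1-e_1^{(cl)}),\qquad \frac{dQ_L}{dt}=Q_{L-1}e_{L-1}^{(cl)}-Q_L(1-e_L^{(cl)}),$$ $$\frac{dQ_k}{dt}=Q_{k-1}e_{k-1}^{(cl)}-Q_k+Q_{k+1}(1-e_{k+1}^{(cl)}),\qquad k=1,\dots,L-1,$$ where $e_k^{(reg)},e_k^{(cl)}$ are the functions of the phase variables defined in the context. The system has equilibria at which $R_L=1-f_{cl}-R_0$, $R_0\in[0,1-f_{cl}]$, $Q_0=f_{cl}$, and all the other phase variables ($R_1,\dots,R_{L-1}$, $Q_1,\dots,Q_L$) are equal to zero; that is, for every $R_0\in[0,1-f_{cl}]$ this point is an equilibrium (all right-hand sides vanish there). At these equilibria $p_c=1$.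
   Context: Reputation levels are $r_k=k/L$, $k=0,\dots,L$. $R_k$ and $Q_k$ are the proportions (of the whole community) of regular members and clique members, respectively, with reputation $r_k$; $f_{cl}$ is the fraction of clique members. Put $a_k=r_k(1+\alpha(1-r_k))$ and $c_k=r_k(1+\sigma(1-r_k))$. Documents have type $g$ (generic), $q$ (supporting the clique) or $\bar q$ (contradicting the clique), and are authentic ($A$) or fake ($F$). Selection probabilities: with $D=\sum_{i=0}^Lr_i(R_i+Q_i)$, $s_k^{(reg)}=r_kR_k/D$ and $s_k^{(cl)}=r_kQ_k/D$ (no separate convention is specified for $D=0$). Individual probabilities of correct evaluation of authentic documents ($p_{c,ind}$) and of mistaken evaluation of fake documents as authentic ($p_{m,ind}$), all sums over $k=0,\dots,L$: $p_{c,ind}(g,A)=\sum s_k^{(reg)}c_k+\tfrac12\sum s_k^{(cl)}$, $\;p_{m,ind}(g,F)=\sum s_k^{(reg)}(1-c_k)+\tfrac12\sum s_k^{(cl)}$, $p_{c,ind}(q,A)=\sum s_k^{(reg)}c_k+\sum s_k^{(cl)}$, $\;p_{m,ind}(q,F)=\sum s_k^{(reg)}(1-c_k)+\sum s_k^{(cl)}$, $p_{c,ind}(\bar q,A)=\sum s_k^{(reg)}c_k$, $\;p_{m,ind}(\bar q,F)=\sum s_k^{(reg)}(1-c_k)$. Majority-of-three probabilities: for each type $x\in\{g,q,\bar q\}$, $p_c(x,A)=p_{c,ind}(x,A)^2\,(3-2p_{c,ind}(x,A))$ and $p_m(x,F)=p_{m,ind}(x,F)^2\,(3-2p_{m,ind}(x,F))$.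 Probabilities that a submitted document is evaluated as authentic: $e_k^{(reg)}=(1-2p_\lambda)[a_kp_c(g,A)+(1-a_k)p_m(g,F)]+p_\lambda[a_kp_c(q,A)+(1-a_k)p_m(q,F)]+p_\lambda[a_kp_c(\bar q,A)+(1-a_k)p_m(\bar q,F)]$, $e_k^{(cl)}=\gamma a_kp_c(q,A)+(1-\gamma a_k)p_m(q,F)$. Overall probability of correct document evaluation: $p_c=\sum_{x\in\{g,q,\bar q\}}\big[Prob(x,A)\,p_c(x,A)+Prob(x,F)\,(1-p_m(x,F))\big]$, where $Prob(g,A)=(1-2p_\lambda)\sum R_ka_k$, $\;Prob(g,F)=(1-2p_\lambda)\sum R_k(1-a_k)$, $Prob(q,A)=p_\lambda\sum R_ka_k+\sum Q_k\gamma a_k$, $\;Prob(q,F)=p_\lambda\sum R_k(1-a_k)+\sum Q_k(1-\gamma a_k)$, $Prob(\bar q,A)=p_\lambda\sum R_ka_k$, $\;Prob(\bar q,F)=p_\lambda\sum R_k(1-a_k)$. *)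

theory Defs
  imports Complex_Main
begin

text \<open>
  A state of the community is a pair of functions \<open>R Q :: nat \<Rightarrow> real\<close>, of which only the values at
  the indices \<open>0, \<dots>, L\<close> matter.  Throughout, \<open>\<alpha>\<close>, \<open>\<sigma>\<close>, \<open>\<gamma>\<close> are the parameters of the model,
  \<open>p\<close> stands for $p_\lambda$ and \<open>f\<close> for $f_{cl}$.
\<close>

definition rep :: "nat \<Rightarrow> nat \<Rightarrow> real" where
  "rep L k = real k / real L"

definition a_coef :: "nat \<Rightarrow> real \<Rightarrow> nat \<Rightarrow> real" where
  "a_coef L \<alpha> k = rep L k * (1 + \<alpha> * (1 - rep L k))"

definition c_coef :: "nat \<Rightarrow> real \<Rightarrow> nat \<Rightarrow> real" where
  "c_coef L \<sigma> k = rep L k * (1 + \<sigma> * (1 - rep L k))"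

text \<open>
  For \<open>total_rep L R Q = 0\<close> (nobody has positive reputation) the quotients below are \<open>0\<close>, since
  \<open>x / 0 = 0\<close>: nobody is selected, so all individual probabilities \<open>pc_ind\<close> and \<open>pm_ind\<close> are \<open>0\<close>.
\<close>

definition total_rep :: "nat \<Rightarrow> (nat \<Rightarrow> real) \<Rightarrow> (nat \<Rightarrow> real) \<Rightarrow> real" where
  "total_rep L R Q = (\<Sum>i\<le>L. rep L i * (R i + Q i))"

definition s_reg :: "nat \<Rightarrow> (nat \<Rightarrow> real) \<Rightarrow> (nat \<Rightarrow> real) \<Rightarrow> nat \<Rightarrow> real" where
  "s_reg L R Q k = rep L k * R k / total_rep L R Q"

definition s_cl :: "nat \<Rightarrow> (nat \<Rightarrow> real) \<Rightarrow> (nat \<Rightarrow> real) \<Rightarrow> nat \<Rightarrow> real" where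
  "s_cl L R Q k = rep L k * Q k / total_rep L R Q"

datatype doc_type = Generic | Supporting | Contradicting

text \<open>
  A selected clique member declares authentic a generic document with probability $1/2$, a document
  supporting the clique always and one contradicting it never, whether or not it is authentic.
\<close>

fun clique_weight :: "doc_type \<Rightarrow> real" where
  "clique_weight Generic = 1/2"
| "clique_weight Supporting = 1"
| "clique_weight Contradicting = 0"

definition pc_ind :: "nat \<Rightarrow> real \<Rightarrow> (nat \<Rightarrow> real) \<Rightarrow> (nat \<Rightarrow> real) \<Rightarrow> doc_type \<Rightarrow> real" where
  "pc_ind L \<sigma> R Q x =
     (\<Sum>k\<le>L. s_reg L R Q k * c_coef L \<sigma> k) + clique_weight x * (\<Sum>k\<le>L. s_cl L R Q k)"

definition pm_ind :: "nat \<Rightarrow> real \<Rightarrow> (nat \<Rightarrow> real) \<Rightarrow> (nat \<Rightarrow> real) \<Rightarrow> doc_type \<Rightarrow> real" where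
  "pm_ind L \<sigma> R Q x =
     (\<Sum>k\<le>L. s_reg L R Q k * (1 - c_coef L \<sigma> k)) + clique_weight x * (\<Sum>k\<le>L. s_cl L R Q k)"

text \<open>Probability that at least two of three independent events of probability \<open>q\<close> occur.\<close>

definition majority3 :: "real \<Rightarrow> real" where
  "majority3 q = q\<^sup>2 * (3 - 2 * q)"

definition pc_maj :: "nat \<Rightarrow> real \<Rightarrow> (nat \<Rightarrow> real) \<Rightarrow> (nat \<Rightarrow> real) \<Rightarrow> doc_type \<Rightarrow> real" where
  "pc_maj L \<sigma> R Q x = majority3 (pc_ind L \<sigma> R Q x)"

definition pm_maj :: "nat \<Rightarrow> real \<Rightarrow> (nat \<Rightarrow> real) \<Rightarrow> (nat \<Rightarrow> real) \<Rightarrow> doc_type \<Rightarrow> real" where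
  "pm_maj L \<sigma> R Q x = majority3 (pm_ind L \<sigma> R Q x)"

definition e_reg ::
  "nat \<Rightarrow> real \<Rightarrow> real \<Rightarrow> real \<Rightarrow> (nat \<Rightarrow> real) \<Rightarrow> (nat \<Rightarrow> real) \<Rightarrow> nat \<Rightarrow> real" where
  "e_reg L \<alpha> \<sigma> p R Q k =
     (1 - 2 * p) * (a_coef L \<alpha> k * pc_maj L \<sigma> R Q Generic
                    + (1 - a_coef L \<alpha> k) * pm_maj L \<sigma> R Q Generic)
     + p * (a_coef L \<alpha> k * pc_maj L \<sigma> R Q Supporting
            + (1 - a_coef L \<alpha> k) * pm_maj L \<sigma> R Q Supporting)
     + p * (a_coef L \<alpha> k * pc_maj L \<sigma> R Q Contradicting
            + (1 - a_coef L \<alpha> k) * pm_maj L \<sigma> R Q Contradicting)"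

definition e_cl ::
  "nat \<Rightarrow> real \<Rightarrow> real \<Rightarrow> real \<Rightarrow> (nat \<Rightarrow> real) \<Rightarrow> (nat \<Rightarrow> real) \<Rightarrow> nat \<Rightarrow> real" where
  "e_cl L \<alpha> \<sigma> \<gamma> R Q k =
     \<gamma> * a_coef L \<alpha> k * pc_maj L \<sigma> R Q Supporting
     + (1 - \<gamma> * a_coef L \<alpha> k) * pm_maj L \<sigma> R Q Supporting"

fun prob_authentic ::
  "nat \<Rightarrow> real \<Rightarrow> real \<Rightarrow> real \<Rightarrow> (nat \<Rightarrow> real) \<Rightarrow> (nat \<Rightarrow> real) \<Rightarrow> doc_type \<Rightarrow> real" where
  "prob_authentic L \<alpha> \<gamma> p R Q Generic = (1 - 2 * p) * (\<Sum>k\<le>L. R k * a_coef L \<alpha> k)"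
| "prob_authentic L \<alpha> \<gamma> p R Q Supporting =
     p * (\<Sum>k\<le>L. R k * a_coef L \<alpha> k) + (\<Sum>k\<le>L. Q k * (\<gamma> * a_coef L \<alpha> k))"
| "prob_authentic L \<alpha> \<gamma> p R Q Contradicting = p * (\<Sum>k\<le>L. R k * a_coef L \<alpha> k)"

fun prob_fake ::
  "nat \<Rightarrow> real \<Rightarrow> real \<Rightarrow> real \<Rightarrow> (nat \<Rightarrow> real) \<Rightarrow> (nat \<Rightarrow> real) \<Rightarrow> doc_type \<Rightarrow> real" where
  "prob_fake L \<alpha> \<gamma> p R Q Generic = (1 - 2 * p) * (\<Sum>k\<le>L. R k * (1 - a_coef L \<alpha> k))"
| "prob_fake L \<alpha> \<gamma> p R Q Supporting =
     p * (\<Sum>k\<le>L. R k * (1 - a_coef L \<alpha> k)) + (\<Sum>k\<le>L. Q k * (1 - \<gamma> * a_coef L \<alpha> k))"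
| "prob_fake L \<alpha> \<gamma> p R Q Contradicting = p * (\<Sum>k\<le>L. R k * (1 - a_coef L \<alpha> k))"

definition p_correct ::
  "nat \<Rightarrow> real \<Rightarrow> real \<Rightarrow> real \<Rightarrow> real \<Rightarrow> (nat \<Rightarrow> real) \<Rightarrow> (nat \<Rightarrow> real) \<Rightarrow> real" where
  "p_correct L \<alpha> \<sigma> \<gamma> p R Q =
     (\<Sum>x\<in>{Generic, Supporting, Contradicting}.
        prob_authentic L \<alpha> \<gamma> p R Q x * pc_maj L \<sigma> R Q x
        + prob_fake L \<alpha> \<gamma> p R Q x * (1 - pm_maj L \<sigma> R Q x))"

text \<open>
  The equations for \<open>R\<close> and for \<open>Q\<close> have the same shape; \<open>chain_rhs L e X k\<close> (for \<open>k \<le> L\<close>) is the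
  right-hand side of the equation for \<open>dX\<^sub>k/dt\<close>, where \<open>e\<close> are the evaluation probabilities.
\<close>

definition chain_rhs :: "nat \<Rightarrow> (nat \<Rightarrow> real) \<Rightarrow> (nat \<Rightarrow> real) \<Rightarrow> nat \<Rightarrow> real" where
  "chain_rhs L e X k =
     (if k = 0 then - X 0 * e 0 + X 1 * (1 - e 1)
      else if k = L then X (L - 1) * e (L - 1) - X L * (1 - e L)
      else X (k - 1) * e (k - 1) - X k + X (k + 1) * (1 - e (k + 1)))"

definition R_rhs ::
  "nat \<Rightarrow> real \<Rightarrow> real \<Rightarrow> real \<Rightarrow> (nat \<Rightarrow> real) \<Rightarrow> (nat \<Rightarrow> real) \<Rightarrow> nat \<Rightarrow> real" where
  "R_rhs L \<alpha> \<sigma> p R Q k = chain_rhs L (e_reg L \<alpha> \<sigma> p R Q) R k"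

definition Q_rhs ::
  "nat \<Rightarrow> real \<Rightarrow> real \<Rightarrow> real \<Rightarrow> (nat \<Rightarrow> real) \<Rightarrow> (nat \<Rightarrow> real) \<Rightarrow> nat \<Rightarrow> real" where
  "Q_rhs L \<alpha> \<sigma> \<gamma> R Q k = chain_rhs L (e_cl L \<alpha> \<sigma> \<gamma> R Q) Q k"

definition phase_space :: "nat \<Rightarrow> real \<Rightarrow> ((nat \<Rightarrow> real) \<times> (nat \<Rightarrow> real)) set" where
  "phase_space L f = {(R, Q). (\<forall>k\<le>L. 0 \<le> R k \<and> 0 \<le> Q k)
                              \<and> (\<Sum>k\<le>L. R k) = 1 - f \<and> (\<Sum>k\<le>L. Q k) = f}"

definition is_equilibrium ::
  "nat \<Rightarrow> real \<Rightarrow> real \<Rightarrow> real \<Rightarrow> real \<Rightarrow> real \<Rightarrow> (nat \<Rightarrow> real) \<Rightarrow> (nat \<Rightarrow> real) \<Rightarrow> bool" where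
  "is_equilibrium L \<alpha> \<sigma> \<gamma> p f R Q \<longleftrightarrow>
     (R, Q) \<in> phase_space L f
     \<and> (\<forall>k\<le>L. R_rhs L \<alpha> \<sigma> p R Q k = 0 \<and> Q_rhs L \<alpha> \<sigma> \<gamma> R Q k = 0)"

end

theory Submission
  imports Defs
begin

text \<open>
  Only regular members of reputation \<open>1\<close> are ever selected, and they never err, so fake documents
  are never accepted and, if somebody has reputation \<open>1\<close>, authentic ones always are.  Members of
  reputation \<open>0\<close> submit fake documents only and those of reputation \<open>1\<close> authentic ones only, so no
  reputation changes.  For \<open>R\<^sub>0 = 1 - f\<close>, where \<open>total_rep\<close> vanishes, every document is rejected, but
  then every submitted document is fake.
\<close>

text \<open>Every term is a flow: \<open>X i * e i\<close> leaves level i upwards,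
  \<open>X i * (1 - e i)\<close> downwards. Empty inner levels send nothing, so only the flows up
  from 0 and down from \<open>L\<close> have to be excluded.\<close>

lemma chain_rhs_eq_0:
  assumes "0 < L" "k \<le> L" and "\<And>i. 0 < i \<Longrightarrow> i < L \<Longrightarrow> X i = 0"
    and "X 0 * e 0 = 0" and "X L * (1 - e L) = 0"
  shows "chain_rhs L e X k = 0"
proof -
  have down: "X i * e i = 0" if "i < L" for i
    using that assms(3)[of i] assms(4) by (cases "i = 0") auto
  have up: "X i * (1 - e i) = 0" if "0 < i" "i \<le> L" for i
    using that assms(3)[of i] assms(5) by (cases "i = L") auto
  consider "k = 0" | "k = L" "0 < k" | "0 < k" "k < L"
    using \<open>k \<le> L\<close> by linarith
  then show ?thesis
  proof cases
    case 1
    then show ?thesis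
      using down[of 0] up[of 1] \<open>0 < L\<close> by (auto simp: chain_rhs_def)
  next
    case 2
    then show ?thesis
      using down[of "L - 1"] up[of L] by (auto simp: chain_rhs_def)
  next
    case 3
    then show ?thesis
      using down[of "k - 1"] up[of "k + 1"] assms(3)[of k] by (auto simp: chain_rhs_def)
  qed
qed

lemma sum_atMost_eq_endpoints:
  fixes g :: "nat \<Rightarrow> real"
  assumes "0 < L" and "\<And>k. 0 < k \<Longrightarrow> k < L \<Longrightarrow> g k = 0"
  shows "(\<Sum>k\<le>L. g k) = g 0 + g L"
proof -
  have "(\<Sum>k\<le>L. g k) = (\<Sum>k\<in>{0, L}. g k)"
    using assms by (intro sum.mono_neutral_right) auto
  with \<open>0 < L\<close> show ?thesis by simp
qed

lemma rep_endpoints [simp]: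
  "rep L 0 = 0" "0 < L \<Longrightarrow> rep L L = 1"
  by (simp_all add: rep_def)

lemma coef_endpoints [simp]:
  "a_coef L \<alpha> 0 = 0" "0 < L \<Longrightarrow> a_coef L \<alpha> L = 1"
  "c_coef L \<sigma> 0 = 0" "0 < L \<Longrightarrow> c_coef L \<sigma> L = 1"
  by (simp_all add: a_coef_def c_coef_def)

lemma majority3_simps [simp]: "majority3 0 = 0" "majority3 1 = 1"
  by (simp_all add: majority3_def)

context
  fixes L :: nat and R Q :: "nat \<Rightarrow> real"
  assumes L: "0 < L"
    and R_inner: "\<And>k. 0 < k \<Longrightarrow> k < L \<Longrightarrow> R k = 0"
    and Q_pos: "\<And>k. 0 < k \<Longrightarrow> k \<le> L \<Longrightarrow> Q k = 0"
begin

lemma total_rep_endpoints: "total_rep L R Q = R L"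
  unfolding total_rep_def using L R_inner Q_pos by (subst sum_atMost_eq_endpoints) auto

lemma s_cl_endpoints: "k \<le> L \<Longrightarrow> s_cl L R Q k = 0"
  using Q_pos[of k] by (cases "k = 0") (auto simp: s_cl_def)

text \<open>At level 0 the numerator of \<open>s_reg\<close> vanishes, at level \<open>L\<close> the
  error factor \<open>1 - c_coef\<close> does; hence no case split on \<open>R L\<close>.\<close>

lemma pm_maj_endpoints: "pm_maj L \<sigma> R Q x = 0"
proof -
  have "(\<Sum>k\<le>L. s_reg L R Q k * (1 - c_coef L \<sigma> k)) = 0"
    using L R_inner by (subst sum_atMost_eq_endpoints) (auto simp: s_reg_def)
  then show ?thesis by (simp add: pm_maj_def pm_ind_def s_cl_endpoints)
qed

text \<open>The only surviving summand is \<open>R L / R L\<close>, which division by zero makes 0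
  when \<open>R L = 0\<close>.\<close>

lemma pc_maj_endpoints: "pc_maj L \<sigma> R Q x = (if R L = 0 then 0 else 1)"
proof -
  have "(\<Sum>k\<le>L. s_reg L R Q k * c_coef L \<sigma> k) = (if R L = 0 then 0 else 1)"
    using L R_inner
    by (subst sum_atMost_eq_endpoints) (auto simp: s_reg_def total_rep_endpoints)
  then show ?thesis by (simp add: pc_maj_def pc_ind_def s_cl_endpoints)
qed

text \<open>At level 0 only the \<open>pm_maj\<close> terms of \<open>e_reg\<close> remain, and they
  vanish. At level \<open>L\<close>, either \<open>R L = 0\<close> or \<open>e_reg\<close> is (1 -
  2p) + p + p = 1.\<close>

lemma R_rhs_endpoints: "k \<le> L \<Longrightarrow> R_rhs L \<alpha> \<sigma> p R Q k = 0"
  unfolding R_rhs_def using L R_inner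
  by (intro chain_rhs_eq_0) (auto simp: e_reg_def pm_maj_endpoints pc_maj_endpoints)

text \<open>Here the flow down from \<open>L\<close> vanishes because \<open>Q L = 0\<close>,
  whatever the value of \<open>e_cl\<close> there.\<close>

lemma Q_rhs_endpoints: "k \<le> L \<Longrightarrow> Q_rhs L \<alpha> \<sigma> \<gamma> R Q k = 0"
  unfolding Q_rhs_def using L Q_pos
  by (intro chain_rhs_eq_0) (auto simp: e_cl_def pm_maj_endpoints)

lemma p_correct_endpoints: "p_correct L \<alpha> \<sigma> \<gamma> p R Q = R 0 + R L + Q 0"
proof -
  have "(\<Sum>k\<le>L. R k * a_coef L \<alpha> k) = R L" "(\<Sum>k\<le>L. R k * (1 - a_coef L \<alpha> k)) = R 0"
    "(\<Sum>k\<le>L. Q k * (\<gamma> * a_coef L \<alpha> k)) = 0" "(\<Sum>k\<le>L. Q k * (1 - \<gamma> * a_coef L \<alpha> k)) = Q 0"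
    using L R_inner Q_pos by (subst sum_atMost_eq_endpoints; auto)+
  \<comment> \<open>The type weights again add up to 1. The authentic part is \<open>R L\<close>
    times \<open>pc_maj\<close>, which equals \<open>R L\<close> in both cases; the fake part is
    \<open>R 0 + Q 0\<close>, all rejected.\<close>
  then show ?thesis
    by (auto simp: p_correct_def pm_maj_endpoints pc_maj_endpoints algebra_simps)
qed

end

theorem proposition5p1:
  fixes L :: nat and \<alpha> \<sigma> \<gamma> p f :: real
  assumes "3 \<le> L"
    and "\<alpha> \<in> {-1..1}" and "\<sigma> \<in> {-1..1}"
    and "\<gamma> \<in> {0..1}" and "p \<in> {0..1/2}" and "f \<in> {0..1}"
  shows "\<forall>R0 \<in> {0..1 - f}.
    let R = (\<lambda>k. if k = 0 then R0 else if k = L then 1 - f - R0 else 0);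
        Q = (\<lambda>k. if k = 0 then f else 0)
    in is_equilibrium L \<alpha> \<sigma> \<gamma> p f R Q \<and> p_correct L \<alpha> \<sigma> \<gamma> p R Q = 1"
proof
  fix R0 assume R0: "R0 \<in> {0..1 - f}"
  define R where "R = (\<lambda>k. if k = 0 then R0 else if k = L then 1 - f - R0 else 0)"
  define Q where "Q = (\<lambda>k::nat. if k = 0 then f else 0)"
  have L: "0 < L" using assms(1) by simp
  have R: "R k = 0" if "0 < k" "k < L" for k using that by (simp add: R_def)
  have Q: "Q k = 0" if "0 < k" "k \<le> L" for k using that by (simp add: Q_def)
  have "(\<Sum>k\<le>L. R k) = 1 - f" "(\<Sum>k\<le>L. Q k) = f"
    using L R Q by (simp_all add: sum_atMost_eq_endpoints) (simp_all add: R_def Q_def)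
  moreover have "0 \<le> R k" "0 \<le> Q k" for k
    using R0 assms(6) by (auto simp: R_def Q_def)
  ultimately have "is_equilibrium L \<alpha> \<sigma> \<gamma> p f R Q"
    using L R Q
    by (simp add: is_equilibrium_def phase_space_def R_rhs_endpoints Q_rhs_endpoints)
  \<comment> \<open>The value is the total population R0 + (1 - f - R0) + f.\<close>
  moreover have "p_correct L \<alpha> \<sigma> \<gamma> p R Q = 1"
    using L R Q by (simp add: p_correct_endpoints) (simp add: R_def Q_def)
  ultimately show "let R = (\<lambda>k. if k = 0 then R0 else if k = L then 1 - f - R0 else 0);
        Q = (\<lambda>k. if k = 0 then f else 0)
    in is_equilibrium L \<alpha> \<sigma> \<gamma> p f R Q \<and> p_correct L \<alpha> \<sigma> \<gamma> p R Q = 1"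
    by (simp add: R_def Q_def Let_def)
qed

end
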